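(* For $1\le\iota\le n$, let $F_\iota(r,s,i,j)$ denote the $(\iota,\iota)$-coordinate function $([r,s]+ij)_{\iota\iota}$ after the strictly lower triangular coordinates of $s$ have been eliminated, viewed as a function on $T^*(\mathfrak{b}\times\mathbb{C}^n)^{rss}$. Then $$F_\iota(r,s,i,j)=\left[\mathrm{tr}\Big(\prod_{1\le k\le n,\,k\neq\iota}l_k(r)\Big)\right]^{-1}\mathrm{tr}\Big(j\Big(\prod_{1\le k\le n,\,k\ne\iota}l_k(r)\Big)i\Big),$$ and this is a $B$-invariant function.
   Context: Let $n\ge 1$, $\mathfrak{g}=\mathfrak{gl}_n(\mathbb{C})$, $B\subset GL_n(\mathbb{C})$ the group of invertible upper triangular matrices, $\mathfrak{b}$ the upper triangular matrices, $\mathfrak{u}\subset\mathfrak{g}$ the strictly upper triangular matrices. Identify $\mathfrak{b}^*\cong\mathfrak{g}/\mathfrak{u}$ via the trace pairing; $\overline{v}$ is the class of $v$ in $\mathfrak{g}/\mathfrak{u}$; an element of $\mathfrak{b}^*$ has a unique lower triangular representative $s=(s_{\iota\gamma})$. $T^*(\mathfrak{b}\times\mathbb{C}^n)=\mathfrak{b}\times\mathfrak{b}^*\times\mathbb{C}^n\times(\mathbb{C}^n)^*$ has points $(r,s,i,j)$, $i=(x_1,\ldots,x_n)^t$ a column vector and $j=(y_1,\ldots,y_n)$ a row vector; $T^*(\mathfrak{b}\times\mathbb{C}^n)^{rss}$ is the locus where $r$ has pairwise distinct eigenvalues (= diagonal entries). $B$ acts by $b.(r,s,i,j)=(brb^{-1},\overline{bsb^{-1}},bi,jb^{-1})$.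 For $r=(r_{\iota\gamma})\in\mathfrak{b}$, $l_k(r)=r-r_{kk}I_n$ (empty product is $I_n$). Elimination: for $\iota>\gamma$ the equation $([r,s]+ij)_{\iota\gamma}=0$ is solved for $$s_{\iota\gamma}=\frac{1}{r_{\gamma\gamma}-r_{\iota\iota}}\Big(\sum_{k>\iota}r_{\iota k}s_{k\gamma}-\sum_{k<\gamma}s_{\iota k}r_{k\gamma}+x_\iota y_\gamma\Big),$$ recursively for $\iota-\gamma=n-1,n-2,\ldots,1$, which expresses every $s_{\iota\gamma}$ with $\iota>\gamma$ through the $r$, $x$, $y$ variables. Substituting these in $$([r,s]+ij)_{\iota\iota}=\sum_{k>\iota}r_{\iota k}s_{k\iota}-\sum_{k<\iota}s_{\iota k}r_{k\iota}+x_\iota y_\iota$$ (which does not involve any diagonal coordinate of $s$) gives $F_\iota$. *)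

theory Defs
  imports
    "Jordan_Normal_Form.Gauss_Jordan_Elimination"
    "Jordan_Normal_Form.Char_Poly"
begin

text \<open>Matrices are those of the \<open>Jordan_Normal_Form\<close> library, so rows and columns are indexed by
  \<open>0, \<dots>, n - 1\<close>. Column vectors are \<open>n \<times> 1\<close> and row vectors \<open>1 \<times> n\<close> matrices, so that
  \<open>i * j\<close> is an \<open>n \<times> n\<close> matrix and \<open>j * A * i\<close> a \<open>1 \<times> 1\<close> matrix.\<close>

definition mat_trace :: "'a::comm_monoid_add mat \<Rightarrow> 'a" where
  "mat_trace A = (\<Sum>k<dim_row A. A $$ (k, k))"

definition borel_group :: "nat \<Rightarrow> complex mat set" where
  "borel_group n = {b \<in> carrier_mat n n. upper_triangular b \<and> invertible_mat b}"

definition borel_alg :: "nat \<Rightarrow> complex mat set" where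
  "borel_alg n = {r \<in> carrier_mat n n. upper_triangular r}"

definition strict_upper :: "nat \<Rightarrow> complex mat set" where
  "strict_upper n = {w \<in> carrier_mat n n. \<forall>\<iota><n. \<forall>\<gamma>\<le>\<iota>. w $$ (\<iota>, \<gamma>) = 0}"

definition lower_mats :: "nat \<Rightarrow> complex mat set" where
  "lower_mats n = {s \<in> carrier_mat n n. \<forall>\<iota><n. \<forall>\<gamma><n. \<iota> < \<gamma> \<longrightarrow> s $$ (\<iota>, \<gamma>) = 0}"

text \<open>The dual of the Borel subalgebra, identified by the trace pairing with the quotient
  of the space of all matrices by the strictly upper triangular ones; its elements are cosets.\<close>

definition mat_class :: "nat \<Rightarrow> complex mat \<Rightarrow> complex mat set" where
  "mat_class n v = {v + w | w. w \<in> strict_upper n}"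

definition borel_dual :: "nat \<Rightarrow> complex mat set set" where
  "borel_dual n = mat_class n ` carrier_mat n n"

definition lower_rep :: "nat \<Rightarrow> complex mat set \<Rightarrow> complex mat" where
  "lower_rep n S = (THE s. s \<in> S \<and> s \<in> lower_mats n)"

type_synonym point = "complex mat \<times> complex mat set \<times> complex mat \<times> complex mat"

definition cotangent :: "nat \<Rightarrow> point set" where
  "cotangent n =
     borel_alg n \<times> borel_dual n \<times> carrier_mat n 1 \<times> carrier_mat 1 n"

definition cotangent_rss :: "nat \<Rightarrow> point set" where
  "cotangent_rss n = {(r, S, i, j) \<in> cotangent n. card {a. eigenvalue r a} = n}"

definition borel_act :: "nat \<Rightarrow> complex mat \<Rightarrow> point \<Rightarrow> point" where
  "borel_act n b = (\<lambda>(r, S, i, j).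
     let b' = the (mat_inverse b)
     in (b * r * b', mat_class n (b * lower_rep n S * b'), b * i, j * b'))"

definition borel_invariant_on_rss :: "nat \<Rightarrow> (point \<Rightarrow> complex) \<Rightarrow> bool" where
  "borel_invariant_on_rss n f \<longleftrightarrow>
     (\<forall>b\<in>borel_group n. \<forall>p\<in>cotangent_rss n. f (borel_act n b p) = f p)"

definition moment_mat :: "complex mat \<Rightarrow> complex mat \<Rightarrow> complex mat \<Rightarrow> complex mat \<Rightarrow> complex mat" where
  "moment_mat r s i j = (r * s - s * r) + i * j"

text \<open>The value of \<open>s $$ (\<iota>, \<gamma>)\<close>, for \<open>\<gamma> < \<iota> < n\<close>, obtained by solving
  \<open>moment_mat r s i j $$ (\<iota>, \<gamma>) = 0\<close> recursively for \<open>\<iota> - \<gamma> = n - 1, \<dots>, 1\<close>; outside this range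
  the value \<open>0\<close> is a dummy.\<close>

function elim_entry ::
  "nat \<Rightarrow> complex mat \<Rightarrow> complex mat \<Rightarrow> complex mat \<Rightarrow> nat \<Rightarrow> nat \<Rightarrow> complex" where
  "elim_entry n r i j \<iota> \<gamma> =
     (if \<gamma> < \<iota> \<and> \<iota> < n then
        1 / (r $$ (\<gamma>, \<gamma>) - r $$ (\<iota>, \<iota>)) *
          ((\<Sum>k\<in>{\<iota><..<n}. r $$ (\<iota>, k) * elim_entry n r i j k \<gamma>)
           - (\<Sum>k\<in>{..<\<gamma>}. elim_entry n r i j \<iota> k * r $$ (k, \<gamma>))
           + i $$ (\<iota>, 0) * j $$ (0, \<gamma>))
      else 0)"
  by pat_completeness auto
termination
  by (relation "measure (\<lambda>(n, r, i, j, \<iota>, \<gamma>). n + \<gamma> - \<iota>)") auto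

declare elim_entry.simps [simp del]

definition elim_subst ::
  "nat \<Rightarrow> complex mat \<Rightarrow> complex mat \<Rightarrow> complex mat \<Rightarrow> complex mat \<Rightarrow> complex mat" where
  "elim_subst n r s i j =
     mat n n (\<lambda>(\<iota>, \<gamma>). if \<gamma> < \<iota> then elim_entry n r i j \<iota> \<gamma> else s $$ (\<iota>, \<gamma>))"

definition F_fun :: "nat \<Rightarrow> nat \<Rightarrow> point \<Rightarrow> complex" where
  "F_fun n \<iota> = (\<lambda>(r, S, i, j).
     moment_mat r (elim_subst n r (lower_rep n S) i j) i j $$ (\<iota>, \<iota>))"

definition l_mat :: "nat \<Rightarrow> complex mat \<Rightarrow> nat \<Rightarrow> complex mat" where
  "l_mat n r k = r - r $$ (k, k) \<cdot>\<^sub>m 1\<^sub>m n"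

text \<open>The factors commute, being polynomials in \<open>r\<close>; the product is taken in increasing order.\<close>

definition l_prod :: "nat \<Rightarrow> nat \<Rightarrow> complex mat \<Rightarrow> complex mat" where
  "l_prod n \<iota> r = foldr (\<lambda>k M. l_mat n r k * M) (filter (\<lambda>k. k \<noteq> \<iota>) [0..<n]) (1\<^sub>m n)"


lemma lower_rep_unique:
  assumes "S \<in> borel_dual n"
  shows "\<exists>!s. s \<in> S \<and> s \<in> lower_mats n"
proof -
  obtain v where v: "v \<in> carrier_mat n n" and S: "S = mat_class n v"
    using assms unfolding borel_dual_def by auto
  define w where "w = mat n n (\<lambda>(\<iota>, \<gamma>). if \<iota> < \<gamma> then - v $$ (\<iota>, \<gamma>) else 0)"
  have w: "w \<in> strict_upper n"
    unfolding strict_upper_def w_def by auto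
  show ?thesis
  proof (rule ex1I[of _ "v + w"])
    show "v + w \<in> S \<and> v + w \<in> lower_mats n"
      using w v unfolding S mat_class_def lower_mats_def by (auto simp: w_def)
  next
    fix s assume s: "s \<in> S \<and> s \<in> lower_mats n"
    then obtain w' where w': "s = v + w'" "w' \<in> strict_upper n"
      unfolding S mat_class_def by auto
    have [simp]: "w' \<in> carrier_mat n n" "dim_row w' = n" "dim_col w' = n"
      using w' unfolding strict_upper_def by auto
    have "w' $$ (\<iota>, \<gamma>) = w $$ (\<iota>, \<gamma>)" if "\<iota> < n" "\<gamma> < n" for \<iota> \<gamma>
    proof (cases "\<iota> < \<gamma>")
      case True
      then have "s $$ (\<iota>, \<gamma>) = 0"
        using s that unfolding lower_mats_def by auto
      then have "v $$ (\<iota>, \<gamma>) + w' $$ (\<iota>, \<gamma>) = 0" using w' that v by auto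
      then show ?thesis using True that unfolding w_def
        by (simp add: eq_neg_iff_add_eq_0 add.commute)
    next
      case False
      then show ?thesis using w'(2) that unfolding w_def strict_upper_def by auto
    qed
    then have "w' = w" by (intro eq_matI) (auto simp: w_def)
    then show "s = v + w" using w' by simp
  qed
qed

lemma card_eigenvalues_eq_iff:
  assumes "r \<in> borel_alg n"
  shows "card {a. eigenvalue r a} = n \<longleftrightarrow>
    (\<forall>\<iota><n. \<forall>\<gamma><n. \<iota> \<noteq> \<gamma> \<longrightarrow> r $$ (\<iota>, \<iota>) \<noteq> r $$ (\<gamma>, \<gamma>))"
proof -
  have r: "r \<in> carrier_mat n n" "upper_triangular r"
    using assms unfolding borel_alg_def by auto
  have "{a. eigenvalue r a} = set (diag_mat r)"
    unfolding eigenvalue_root_char_poly[OF r(1)] char_poly_upper_triangular[OF r]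
    by (auto simp: poly_prod_list prod_list_zero_iff)
  moreover have "length (diag_mat r) = n"
    using r unfolding diag_mat_def by auto
  ultimately have "card {a. eigenvalue r a} = n \<longleftrightarrow> distinct (diag_mat r)"
    by (metis card_distinct distinct_card)
  also have "\<dots> \<longleftrightarrow> (\<forall>\<iota><n. \<forall>\<gamma><n. \<iota> \<noteq> \<gamma> \<longrightarrow> r $$ (\<iota>, \<iota>) \<noteq> r $$ (\<gamma>, \<gamma>))"
    using r unfolding diag_mat_def distinct_conv_nth by auto
  finally show ?thesis .
qed

lemma moment_mat_entry:
  assumes r: "r \<in> borel_alg n" and s: "s \<in> lower_mats n"
    and i: "i \<in> carrier_mat n 1" and j: "j \<in> carrier_mat 1 n"
    and \<iota>: "\<iota> < n" and \<gamma>: "\<gamma> \<le> \<iota>"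
  shows "moment_mat r s i j $$ (\<iota>, \<gamma>) =
    (r $$ (\<iota>, \<iota>) - r $$ (\<gamma>, \<gamma>)) * s $$ (\<iota>, \<gamma>)
    + (\<Sum>k\<in>{\<iota><..<n}. r $$ (\<iota>, k) * s $$ (k, \<gamma>))
    - (\<Sum>k\<in>{..<\<gamma>}. s $$ (\<iota>, k) * r $$ (k, \<gamma>))
    + i $$ (\<iota>, 0) * j $$ (0, \<gamma>)"
proof -
  have rc: "r \<in> carrier_mat n n" and sc: "s \<in> carrier_mat n n"
    using r s unfolding borel_alg_def lower_mats_def by auto
  have r0: "r $$ (a, c) = 0" if "c < a" "a < n" for a c
    using r that unfolding borel_alg_def by auto
  have s0: "s $$ (a, c) = 0" if "a < c" "c < n" for a c
    using s that unfolding lower_mats_def by auto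
  have "moment_mat r s i j $$ (\<iota>, \<gamma>) =
     (\<Sum>k<n. r $$ (\<iota>, k) * s $$ (k, \<gamma>)) - (\<Sum>k<n. s $$ (\<iota>, k) * r $$ (k, \<gamma>))
      + i $$ (\<iota>, 0) * j $$ (0, \<gamma>)"
    using rc sc i j \<iota> \<gamma> unfolding moment_mat_def
    by (auto simp: scalar_prod_def lessThan_atLeast0)
  also have "(\<Sum>k<n. r $$ (\<iota>, k) * s $$ (k, \<gamma>)) =
     (\<Sum>k\<in>insert \<iota> {\<iota><..<n}. r $$ (\<iota>, k) * s $$ (k, \<gamma>))"
    by (rule sum.mono_neutral_right) (use \<iota> r0 in auto)
  also have "\<dots> = r $$ (\<iota>, \<iota>) * s $$ (\<iota>, \<gamma>) + (\<Sum>k\<in>{\<iota><..<n}. r $$ (\<iota>, k) * s $$ (k, \<gamma>))"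
    by simp
  also have "(\<Sum>k<n. s $$ (\<iota>, k) * r $$ (k, \<gamma>)) =
     (\<Sum>k\<in>insert \<gamma> {..<\<gamma>}. s $$ (\<iota>, k) * r $$ (k, \<gamma>))"
    by (rule sum.mono_neutral_right) (use \<iota> \<gamma> r0 in auto)
  also have "\<dots> = s $$ (\<iota>, \<gamma>) * r $$ (\<gamma>, \<gamma>) + (\<Sum>k\<in>{..<\<gamma>}. s $$ (\<iota>, k) * r $$ (k, \<gamma>))"
    by simp
  finally show ?thesis by (simp add: algebra_simps)
qed

lemma elim_entry_correct:
  assumes p: "(r, S, i, j) \<in> cotangent_rss n" and s: "s \<in> lower_mats n"
  shows "(\<forall>\<iota><n. \<forall>\<gamma><\<iota>. moment_mat r s i j $$ (\<iota>, \<gamma>) = 0) \<longleftrightarrow>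
         (\<forall>\<iota><n. \<forall>\<gamma><\<iota>. s $$ (\<iota>, \<gamma>) = elim_entry n r i j \<iota> \<gamma>)"
proof -
  have r: "r \<in> borel_alg n" and i: "i \<in> carrier_mat n 1" and j: "j \<in> carrier_mat 1 n"
    using p unfolding cotangent_rss_def cotangent_def by auto
  have d: "r $$ (\<gamma>, \<gamma>) - r $$ (\<iota>, \<iota>) \<noteq> 0" if "\<iota> < n" "\<gamma> < \<iota>" for \<iota> \<gamma>
  proof -
    have "card {a. eigenvalue r a} = n" using p unfolding cotangent_rss_def by auto
    then show ?thesis using card_eigenvalues_eq_iff[OF r] that by auto
  qed
  have eq: "moment_mat r s i j $$ (\<iota>, \<gamma>) = 0 \<longleftrightarrow>
     s $$ (\<iota>, \<gamma>) = 1 / (r $$ (\<gamma>, \<gamma>) - r $$ (\<iota>, \<iota>)) *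
          ((\<Sum>k\<in>{\<iota><..<n}. r $$ (\<iota>, k) * s $$ (k, \<gamma>))
           - (\<Sum>k\<in>{..<\<gamma>}. s $$ (\<iota>, k) * r $$ (k, \<gamma>))
           + i $$ (\<iota>, 0) * j $$ (0, \<gamma>))" if "\<iota> < n" "\<gamma> < \<iota>" for \<iota> \<gamma>
  proof -
    have *: "(a - c) * x + P - Q + R = 0 \<longleftrightarrow> x = 1 / (c - a) * (P - Q + R)"
      if "c - a \<noteq> 0" for a c x P Q R :: complex
    proof -
      have "x = 1 / (c - a) * (P - Q + R) \<longleftrightarrow> x * (c - a) = P - Q + R"
        using that by (simp add: eq_divide_eq)
      then show ?thesis by (auto simp: algebra_simps)
    qed
    show ?thesis
      unfolding moment_mat_entry[OF r s i j that(1) less_imp_le[OF that(2)]]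
      by (rule *[OF d[OF that]])
  qed
  show ?thesis
  proof
    assume L: "\<forall>\<iota><n. \<forall>\<gamma><\<iota>. moment_mat r s i j $$ (\<iota>, \<gamma>) = 0"
    have "\<gamma> < \<iota> \<Longrightarrow> \<iota> < n \<Longrightarrow> s $$ (\<iota>, \<gamma>) = elim_entry n r i j \<iota> \<gamma>" for \<iota> \<gamma>
    proof (induction "n + \<gamma> - \<iota>" arbitrary: \<iota> \<gamma> rule: less_induct)
      case less
      have "(\<Sum>k\<in>{\<iota><..<n}. r $$ (\<iota>, k) * s $$ (k, \<gamma>)) =
            (\<Sum>k\<in>{\<iota><..<n}. r $$ (\<iota>, k) * elim_entry n r i j k \<gamma>)"
        using less.prems by (intro sum.cong refl) (auto intro!: less.hyps)
      moreover have "(\<Sum>k\<in>{..<\<gamma>}. s $$ (\<iota>, k) * r $$ (k, \<gamma>)) =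
            (\<Sum>k\<in>{..<\<gamma>}. elim_entry n r i j \<iota> k * r $$ (k, \<gamma>))"
        using less.prems by (intro sum.cong refl) (auto intro!: less.hyps)
      ultimately show ?case
        using eq[OF less.prems(2,1)] L less.prems by (subst elim_entry.simps) auto
    qed
    then show "\<forall>\<iota><n. \<forall>\<gamma><\<iota>. s $$ (\<iota>, \<gamma>) = elim_entry n r i j \<iota> \<gamma>" by blast
  next
    assume R: "\<forall>\<iota><n. \<forall>\<gamma><\<iota>. s $$ (\<iota>, \<gamma>) = elim_entry n r i j \<iota> \<gamma>"
    show "\<forall>\<iota><n. \<forall>\<gamma><\<iota>. moment_mat r s i j $$ (\<iota>, \<gamma>) = 0"
    proof (intro allI impI)
      fix \<iota> \<gamma> assume *: "\<iota> < n" "\<gamma> < \<iota>"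
      have "(\<Sum>k\<in>{\<iota><..<n}. r $$ (\<iota>, k) * s $$ (k, \<gamma>)) =
            (\<Sum>k\<in>{\<iota><..<n}. r $$ (\<iota>, k) * elim_entry n r i j k \<gamma>)"
        using * R by (intro sum.cong refl) auto
      moreover have "(\<Sum>k\<in>{..<\<gamma>}. s $$ (\<iota>, k) * r $$ (k, \<gamma>)) =
            (\<Sum>k\<in>{..<\<gamma>}. elim_entry n r i j \<iota> k * r $$ (k, \<gamma>))"
        using * R by (intro sum.cong refl) auto
      moreover have "s $$ (\<iota>, \<gamma>) = elim_entry n r i j \<iota> \<gamma>" using * R by auto
      ultimately show "moment_mat r s i j $$ (\<iota>, \<gamma>) = 0"
        unfolding eq[OF *] using * by (subst (asm) elim_entry.simps) auto
    qed
  qed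
qed

lemma borel_group_inverse:
  assumes b: "b \<in> borel_group n"
  shows "the (mat_inverse b) \<in> borel_alg n"
    and "b * the (mat_inverse b) = 1\<^sub>m n" and "the (mat_inverse b) * b = 1\<^sub>m n"
proof -
  have bc: "b \<in> carrier_mat n n" and ut: "upper_triangular b" and "invertible_mat b"
    using b unfolding borel_group_def by auto
  then obtain c where c: "inverts_mat b c" "inverts_mat c b"
    unfolding invertible_mat_def by auto
  have "dim_col c = n" "dim_row c = n"
    using c bc unfolding inverts_mat_def
    by (metis carrier_matD(1) index_mult_mat(3) index_one_mat(3),
        metis carrier_matD(2) index_mult_mat(3) index_one_mat(3))
  then have cc: "c \<in> carrier_mat n n" by auto
  have "b \<in> Units (ring_mat TYPE(complex) n ())"
    using bc cc c unfolding Units_def ring_mat_def inverts_mat_def by auto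
  then obtain b' where b': "mat_inverse b = Some b'"
    using mat_inverse(1)[OF bc, of "()"] by (cases "mat_inverse b") auto
  have inv: "b * b' = 1\<^sub>m n" "b' * b = 1\<^sub>m n" "b' \<in> carrier_mat n n"
    using mat_inverse(2)[OF bc b'] by auto
  have *: "\<forall>\<iota><n. \<gamma> < \<iota> \<longrightarrow> b' $$ (\<iota>, \<gamma>) = 0" if "\<gamma> < n" for \<gamma>
    using that
  proof (induction \<gamma> rule: less_induct)
    case (less \<gamma>)
    have col: "(b' * b) $$ (\<iota>, \<gamma>) = b' $$ (\<iota>, \<gamma>) * b $$ (\<gamma>, \<gamma>)" if "\<iota> < n" "\<gamma> \<le> \<iota>" for \<iota>
    proof -
      have "(b' * b) $$ (\<iota>, \<gamma>) = (\<Sum>k<n. b' $$ (\<iota>, k) * b $$ (k, \<gamma>))"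
        using inv(3) bc that less.prems by (auto simp: scalar_prod_def lessThan_atLeast0)
      also have "\<dots> = (\<Sum>k\<in>{\<gamma>}. b' $$ (\<iota>, k) * b $$ (k, \<gamma>))"
      proof (rule sum.mono_neutral_right, simp, use less.prems in simp, intro ballI)
        fix k assume k: "k \<in> {..<n} - {\<gamma>}"
        show "b' $$ (\<iota>, k) * b $$ (k, \<gamma>) = 0"
        proof (cases "k < \<gamma>")
          case True
          then show ?thesis using less.IH[of k] k that by auto
        next
          case False
          then show ?thesis using upper_triangularD[OF ut, of \<gamma> k] k bc by auto
        qed
      qed
      finally show ?thesis by simp
    qed
    have "b $$ (\<gamma>, \<gamma>) \<noteq> 0" using col[of \<gamma>] inv(2) less.prems by auto
    show ?case
    proof (intro allI impI)
      fix \<iota> assume "\<iota> < n" "\<gamma> < \<iota>"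
      then have "b' $$ (\<iota>, \<gamma>) * b $$ (\<gamma>, \<gamma>) = 0"
        using col[of \<iota>] inv(2) by auto
      then show "b' $$ (\<iota>, \<gamma>) = 0" using \<open>b $$ (\<gamma>, \<gamma>) \<noteq> 0\<close> by simp
    qed
  qed
  have "b' \<in> borel_alg n"
    using inv(3) * unfolding borel_alg_def by (auto intro!: upper_triangularI)
  then show "the (mat_inverse b) \<in> borel_alg n"
    "b * the (mat_inverse b) = 1\<^sub>m n" "the (mat_inverse b) * b = 1\<^sub>m n"
    using inv b' by auto
qed

lemma upper_mult_entry:
  assumes "A \<in> carrier_mat n n" "C \<in> carrier_mat n n" "\<iota> < n" "\<gamma> < n"
    and "\<And>k. k < n \<Longrightarrow> A $$ (\<iota>, k) = 0 \<or> C $$ (k, \<gamma>) = 0"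
  shows "(A * C) $$ (\<iota>, \<gamma>) = 0"
proof -
  have "(A * C) $$ (\<iota>, \<gamma>) = (\<Sum>k<n. A $$ (\<iota>, k) * C $$ (k, \<gamma>))"
    using assms(1-4) by (auto simp: scalar_prod_def lessThan_atLeast0)
  also have "\<dots> = 0"
  proof (intro sum.neutral ballI)
    fix k assume "k \<in> {..<n}"
    then show "A $$ (\<iota>, k) * C $$ (k, \<gamma>) = 0" using assms(5)[of k] by auto
  qed
  finally show ?thesis .
qed

lemma borel_alg_mult:
  assumes "A \<in> borel_alg n" "C \<in> borel_alg n"
  shows "A * C \<in> borel_alg n"
proof -
  have A: "A \<in> carrier_mat n n" "\<And>a c. c < a \<Longrightarrow> a < n \<Longrightarrow> A $$ (a, c) = 0"
    using assms(1) unfolding borel_alg_def by auto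
  have C: "C \<in> carrier_mat n n" "\<And>a c. c < a \<Longrightarrow> a < n \<Longrightarrow> C $$ (a, c) = 0"
    using assms(2) unfolding borel_alg_def by auto
  have "(A * C) $$ (\<iota>, \<gamma>) = 0" if "\<gamma> < \<iota>" "\<iota> < n" for \<iota> \<gamma>
  proof (rule upper_mult_entry[OF A(1) C(1)])
    fix k assume "k < n"
    then show "A $$ (\<iota>, k) = 0 \<or> C $$ (k, \<gamma>) = 0"
      using A(2)[of k \<iota>] C(2)[of \<gamma> k] that by (cases "k < \<iota>") auto
  qed (use that in auto)
  then show ?thesis
    using A(1) C(1) unfolding borel_alg_def
    by (auto intro!: upper_triangularI simp del: index_mult_mat(1))
qed

lemma strict_upper_mult:
  assumes "A \<in> borel_alg n" "w \<in> strict_upper n"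
  shows "A * w \<in> strict_upper n" "w * A \<in> strict_upper n"
proof -
  have A: "A \<in> carrier_mat n n" "\<And>a c. c < a \<Longrightarrow> a < n \<Longrightarrow> A $$ (a, c) = 0"
    using assms(1) unfolding borel_alg_def by auto
  have w: "w \<in> carrier_mat n n" "\<And>a c. c \<le> a \<Longrightarrow> a < n \<Longrightarrow> w $$ (a, c) = 0"
    using assms(2) unfolding strict_upper_def by auto
  have "(A * w) $$ (\<iota>, \<gamma>) = 0" "(w * A) $$ (\<iota>, \<gamma>) = 0" if "\<iota> < n" "\<gamma> \<le> \<iota>" for \<iota> \<gamma>
  proof -
    show "(A * w) $$ (\<iota>, \<gamma>) = 0"
    proof (rule upper_mult_entry[OF A(1) w(1)])
      fix k assume "k < n"
      then show "A $$ (\<iota>, k) = 0 \<or> w $$ (k, \<gamma>) = 0"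
        using A(2)[of k \<iota>] w(2)[of \<gamma> k] that by (cases "k < \<iota>") auto
    qed (use that in auto)
    show "(w * A) $$ (\<iota>, \<gamma>) = 0"
    proof (rule upper_mult_entry[OF w(1) A(1)])
      fix k assume "k < n"
      then show "w $$ (\<iota>, k) = 0 \<or> A $$ (k, \<gamma>) = 0"
        using A(2)[of \<gamma> k] w(2)[of k \<iota>] that by (cases "k \<le> \<iota>") auto
    qed (use that in auto)
  qed
  then show "A * w \<in> strict_upper n" "w * A \<in> strict_upper n"
    using A(1) w(1) unfolding strict_upper_def by (auto simp del: index_mult_mat(1))
qed

lemma mat_class_eqI:
  assumes v: "v \<in> carrier_mat n n" and w: "w \<in> strict_upper n"
  shows "mat_class n (v + w) = mat_class n v"
proof -
  have wc: "w \<in> carrier_mat n n" using w unfolding strict_upper_def by auto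
  have "v + w + u = v + (w + u) \<and> w + u \<in> strict_upper n" if "u \<in> strict_upper n" for u
    using that v w wc unfolding strict_upper_def by auto
  moreover have "v + u = v + w + (u - w) \<and> u - w \<in> strict_upper n" if "u \<in> strict_upper n" for u
    using that v w wc unfolding strict_upper_def by auto
  ultimately show ?thesis unfolding mat_class_def by blast
qed

text \<open>The class of the conjugate does not depend on the representative used.\<close>

lemma mat_class_conj:
  assumes b: "b \<in> borel_group n" and S: "S \<in> borel_dual n" and s: "s \<in> S"
  defines "b' \<equiv> the (mat_inverse b)"
  shows "mat_class n (b * lower_rep n S * b') = mat_class n (b * s * b')"
proof -
  obtain v where v: "v \<in> carrier_mat n n" and Sv: "S = mat_class n v"
    using S unfolding borel_dual_def by auto
  have B: "b \<in> borel_alg n" "b' \<in> borel_alg n"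
    using b borel_group_inverse(1)[OF b] unfolding borel_group_def borel_alg_def b'_def by auto
  then have Bc: "b \<in> carrier_mat n n" "b' \<in> carrier_mat n n" unfolding borel_alg_def by auto
  have *: "mat_class n (b * t * b') = mat_class n (b * v * b')" if t: "t \<in> S" for t
  proof -
    obtain w where w: "w \<in> strict_upper n" "t = v + w"
      using t unfolding Sv mat_class_def by auto
    have wc: "w \<in> carrier_mat n n" using w unfolding strict_upper_def by auto
    have "b * t * b' = b * v * b' + b * w * b'"
      unfolding w(2) using Bc v wc
      by (simp add: mult_add_distrib_mat[of _ n n] add_mult_distrib_mat[of _ n n])
    then show ?thesis
      using mat_class_eqI[of "b * v * b'" n "b * w * b'"] Bc v
        strict_upper_mult(2)[OF B(2) strict_upper_mult(1)[OF B(1) w(1)]] by auto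
  qed
  have "lower_rep n S \<in> S"
    unfolding lower_rep_def using theI'[OF lower_rep_unique[OF S]] by auto
  then show ?thesis using * s by auto
qed

lemma borel_act_rss:
  assumes b: "b \<in> borel_group n" and p: "p \<in> cotangent_rss n"
  shows "borel_act n b p \<in> cotangent_rss n"
proof -
  obtain r S i j where p_eq: "p = (r, S, i, j)" by (cases p)
  define b' where "b' = the (mat_inverse b)"
  have B: "b \<in> borel_alg n" "b' \<in> borel_alg n"
    using b borel_group_inverse(1)[OF b] unfolding borel_group_def borel_alg_def b'_def by auto
  then have Bc: "b \<in> carrier_mat n n" "b' \<in> carrier_mat n n" unfolding borel_alg_def by auto
  have r: "r \<in> borel_alg n" and S: "S \<in> borel_dual n" and i: "i \<in> carrier_mat n 1"
    and j: "j \<in> carrier_mat 1 n" and card: "card {a. eigenvalue r a} = n"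
    using p unfolding p_eq cotangent_rss_def cotangent_def by auto
  have rc: "r \<in> carrier_mat n n" using r unfolding borel_alg_def by auto
  have "lower_rep n S \<in> carrier_mat n n"
    unfolding lower_rep_def using theI'[OF lower_rep_unique[OF S]]
    by (auto simp: lower_mats_def)
  then have "mat_class n (b * lower_rep n S * b') \<in> borel_dual n"
    using Bc unfolding borel_dual_def by auto
  moreover have "similar_mat (b * r * b') r"
    using borel_group_inverse(2,3)[OF b] Bc rc
    unfolding similar_mat_def similar_mat_wit_def b'_def
    by (intro exI[of _ b] exI[of _ "the (mat_inverse b)"]) (auto simp: Let_def)
  then have "eigenvalue (b * r * b') a = eigenvalue r a" for a
    using eigenvalue_root_char_poly[of "b * r * b'" n a] eigenvalue_root_char_poly[OF rc, of a]
      char_poly_similar[of "b * r * b'" r] Bc rc by (metis mult_carrier_mat)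
  then have "card {a. eigenvalue (b * r * b') a} = n" using card by simp
  ultimately show ?thesis
    using borel_alg_mult[OF borel_alg_mult[OF B(1) r] B(2)] Bc i j
    unfolding p_eq borel_act_def cotangent_rss_def cotangent_def b'_def by (auto simp: Let_def)
qed

end

theory Submission
  imports Defs
begin

text \<open>
  Write \<open>M = [r, s] + ij\<close> for the matrix obtained after the elimination and \<open>P\<close> for the product of
  the \<open>l\<^sub>k(r)\<close> with \<open>k \<noteq> \<iota>\<close>. The idea is to compute \<open>tr (P M)\<close> in two ways.

  Since \<open>P\<close> is a polynomial in \<open>r\<close>, it commutes with \<open>r\<close>, so \<open>tr (P [r, s]) = 0\<close> by cyclicity of the
  trace, whatever \<open>s\<close> is; hence \<open>tr (P M) = tr (P i j) = tr (j P i)\<close>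
  (\<open>mat_trace_commuting_moment_mat\<close>). On the other hand the elimination makes \<open>M\<close> upper triangular
  with \<open>F\<^sub>\<iota>\<close> as its \<open>\<iota>\<close>-th diagonal entry, and \<open>P\<close> is upper triangular with the single nonzero
  diagonal entry \<open>P\<^sub>\<iota>\<^sub>\<iota>\<close>, the product of the differences \<open>r\<^sub>\<iota>\<^sub>\<iota> - r\<^sub>k\<^sub>k\<close>: the factor \<open>l\<^sub>k(r)\<close> kills the
  \<open>k\<close>-th one (\<open>l_prod_diag\<close>). Hence \<open>tr P = P\<^sub>\<iota>\<^sub>\<iota> \<noteq> 0\<close> and \<open>tr (P M) = P\<^sub>\<iota>\<^sub>\<iota> F\<^sub>\<iota> = tr P \<cdot> F\<^sub>\<iota>\<close>.

  Conjugation by \<open>b \<in> B\<close> preserves the diagonal of \<open>r\<close>, so it carries \<open>P\<close> to \<open>b P b\<inverse>\<close>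
  (\<open>l_prod_conj\<close>), and both traces in the closed formula are visibly unchanged.
\<close>

section \<open>Traces\<close>

lemma mat_trace_add:
  assumes "A \<in> carrier_mat n n" "B \<in> carrier_mat n n"
  shows "mat_trace (A + B) = mat_trace A + mat_trace B"
  using assms unfolding mat_trace_def by (auto simp: sum.distrib)

lemma mat_trace_minus:
  fixes A :: "'a::ab_group_add mat"
  assumes "A \<in> carrier_mat n n" "B \<in> carrier_mat n n"
  shows "mat_trace (A - B) = mat_trace A - mat_trace B"
  using assms unfolding mat_trace_def by (auto simp: sum_subtractf)

lemma mat_trace_mult_comm:
  fixes A :: "'a::comm_semiring_0 mat"
  assumes "A \<in> carrier_mat n m" "B \<in> carrier_mat m n"
  shows "mat_trace (A * B) = mat_trace (B * A)"
proof -
  have "mat_trace (A * B) = (\<Sum>k<n. \<Sum>l<m. A $$ (k, l) * B $$ (l, k))"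
    using assms unfolding mat_trace_def by (auto simp: scalar_prod_def lessThan_atLeast0)
  also have "\<dots> = (\<Sum>l<m. \<Sum>k<n. B $$ (l, k) * A $$ (k, l))"
    by (subst sum.swap) (simp add: mult.commute)
  also have "\<dots> = mat_trace (B * A)"
    using assms unfolding mat_trace_def by (auto simp: scalar_prod_def lessThan_atLeast0)
  finally show ?thesis .
qed

text \<open>For a matrix commuting with \<open>r\<close>, the commutator in the moment map is invisible to the trace.\<close>

lemma mat_trace_commuting_moment_mat:
  assumes P: "P \<in> carrier_mat n n" and r: "r \<in> carrier_mat n n" and s: "s \<in> carrier_mat n n"
    and i: "i \<in> carrier_mat n 1" and j: "j \<in> carrier_mat 1 n"
    and comm: "r * P = P * r"
  shows "mat_trace (P * moment_mat r s i j) = mat_trace (j * P * i)"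
proof -
  have "mat_trace (P * (s * r)) = mat_trace (P * s * r)"
    using P r s by simp
  also have "\<dots> = mat_trace (r * (P * s))"
    using P r s by (intro mat_trace_mult_comm) auto
  also have "r * (P * s) = r * P * s"
    using P r s by simp
  also have "\<dots> = P * (r * s)"
    unfolding comm using P r s by simp
  finally have bracket: "mat_trace (P * (s * r)) = mat_trace (P * (r * s))" .
  have c: "r * s \<in> carrier_mat n n" "s * r \<in> carrier_mat n n" "i * j \<in> carrier_mat n n"
    using r s i j by auto
  then have "P * moment_mat r s i j = (P * (r * s) - P * (s * r)) + P * (i * j)"
    unfolding moment_mat_def using P minus_carrier_mat[OF c(2), of "r * s"]
    by (simp add: mult_add_distrib_mat[of _ n n _ n] mult_minus_distrib_mat[of _ n n _ n])
  then have "mat_trace (P * moment_mat r s i j) = mat_trace (P * (i * j))"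
    using mult_carrier_mat[OF P c(1)] mult_carrier_mat[OF P c(2)] mult_carrier_mat[OF P c(3)] bracket
    by (simp add: mat_trace_add[of _ n] mat_trace_minus[of _ n] minus_carrier_mat)
  also have "P * (i * j) = P * i * j"
    using P i j by simp
  also have "mat_trace (P * i * j) = mat_trace (j * (P * i))"
    using P i j by (intro mat_trace_mult_comm) auto
  also have "j * (P * i) = j * P * i"
    using P i j by simp
  finally show ?thesis .
qed

section \<open>Diagonals of upper triangular matrices\<close>

lemma borel_alg_carrier: "A \<in> borel_alg n \<Longrightarrow> A \<in> carrier_mat n n"
  unfolding borel_alg_def by simp

lemma borel_alg_mult_diag:
  assumes A: "A \<in> borel_alg n" and C: "C \<in> borel_alg n" and k: "k < n"
  shows "(A * C) $$ (k, k) = A $$ (k, k) * C $$ (k, k)"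
proof -
  have "(A * C) $$ (k, k) = (\<Sum>l<n. A $$ (k, l) * C $$ (l, k))"
    using A C k unfolding borel_alg_def by (auto simp: scalar_prod_def lessThan_atLeast0)
  also have "\<dots> = (\<Sum>l\<in>{k}. A $$ (k, l) * C $$ (l, k))"
  proof (rule sum.mono_neutral_right)
    show "\<forall>l\<in>{..<n} - {k}. A $$ (k, l) * C $$ (l, k) = 0"
    proof
      fix l assume "l \<in> {..<n} - {k}"
      then show "A $$ (k, l) * C $$ (l, k) = 0"
        using A C k upper_triangularD[of A l k] upper_triangularD[of C k l]
        unfolding borel_alg_def by (cases "l < k") auto
    qed
  qed (use k in auto)
  finally show ?thesis by simp
qed

lemma borel_conj_diag:
  assumes b: "b \<in> borel_group n" and r: "r \<in> borel_alg n" and k: "k < n"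
  shows "(b * r * the (mat_inverse b)) $$ (k, k) = r $$ (k, k)"
proof -
  let ?b' = "the (mat_inverse b)"
  have B: "b \<in> borel_alg n" and B': "?b' \<in> borel_alg n"
    using b borel_group_inverse(1)[OF b] unfolding borel_group_def borel_alg_def by auto
  have "b $$ (k, k) * ?b' $$ (k, k) = 1"
    using borel_alg_mult_diag[OF B B' k] borel_group_inverse(2)[OF b] k by simp
  then show ?thesis
    using borel_alg_mult_diag[OF borel_alg_mult[OF B r] B' k] borel_alg_mult_diag[OF B r k]
    by (simp add: algebra_simps)
qed

section \<open>The product of the shifted matrices\<close>

lemma l_mat_borel: "r \<in> borel_alg n \<Longrightarrow> l_mat n r k \<in> borel_alg n"
  unfolding l_mat_def borel_alg_def by (auto intro!: upper_triangularI dest: upper_triangularD)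

lemma l_mat_comm:
  assumes r: "r \<in> carrier_mat n n"
  shows "r * l_mat n r k = l_mat n r k * r"
  unfolding l_mat_def using r
  by (simp add: mult_minus_distrib_mat[of _ n n _ n] minus_mult_distrib_mat[of _ n n _ _ n]
      mult_smult_distrib[of _ n n _ n] mult_smult_assoc_mat[of _ n n _ n])

text \<open>The properties of \<open>l_prod\<close> are proved by induction for products over arbitrary lists of
  indices, since removing a factor from \<open>l_prod\<close> does not leave a product of the same shape.\<close>

lemma l_mat_foldr_borel:
  assumes r: "r \<in> borel_alg n"
  shows "foldr (\<lambda>k M. l_mat n r k * M) ks (1\<^sub>m n) \<in> borel_alg n"
proof (induction ks)
  case Nil
  show ?case by (auto simp: borel_alg_def)
next
  case (Cons k ks)
  then show ?case by (simp add: borel_alg_mult l_mat_borel[OF r])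
qed

lemma l_mat_foldr_comm:
  assumes r: "r \<in> borel_alg n"
  shows "r * foldr (\<lambda>k M. l_mat n r k * M) ks (1\<^sub>m n)
       = foldr (\<lambda>k M. l_mat n r k * M) ks (1\<^sub>m n) * r"
proof (induction ks)
  case Nil
  show ?case using borel_alg_carrier[OF r] by simp
next
  case (Cons k ks)
  let ?L = "l_mat n r k" and ?M = "foldr (\<lambda>k M. l_mat n r k * M) ks (1\<^sub>m n)"
  have c: "r \<in> carrier_mat n n" "?L \<in> carrier_mat n n" "?M \<in> carrier_mat n n"
    using r l_mat_borel[OF r] l_mat_foldr_borel[OF r] by (auto intro: borel_alg_carrier)
  have "r * (?L * ?M) = r * ?L * ?M" using c by simp
  also have "\<dots> = ?L * (r * ?M)" using c by (simp add: l_mat_comm)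
  also have "\<dots> = ?L * ?M * r" using c Cons.IH by simp
  finally show ?case by simp
qed

lemma l_mat_foldr_diag:
  assumes r: "r \<in> borel_alg n" and m: "m < n"
  shows "foldr (\<lambda>k M. l_mat n r k * M) ks (1\<^sub>m n) $$ (m, m)
       = (\<Prod>k\<leftarrow>ks. r $$ (m, m) - r $$ (k, k))"
proof (induction ks)
  case Nil
  show ?case using m by simp
next
  case (Cons k ks)
  have "l_mat n r k $$ (m, m) = r $$ (m, m) - r $$ (k, k)"
    using borel_alg_carrier[OF r] m unfolding l_mat_def by auto
  then show ?case
    using Cons.IH borel_alg_mult_diag[OF l_mat_borel[OF r] l_mat_foldr_borel[OF r] m] by simp
qed

text \<open>The scalar subtracted from \<open>r\<close> in \<open>l_mat\<close> is a diagonal entry of \<open>r\<close> and thus fixed under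
  conjugation by the Borel group; this is why the factors, and their products, are equivariant.\<close>

lemma l_mat_conj:
  assumes b: "b \<in> borel_group n" and r: "r \<in> borel_alg n" and k: "k < n"
  defines "b' \<equiv> the (mat_inverse b)"
  shows "l_mat n (b * r * b') k = b * l_mat n r k * b'"
proof -
  have c: "b \<in> carrier_mat n n" "b' \<in> carrier_mat n n" "r \<in> carrier_mat n n"
    using b r borel_group_inverse(1)[OF b] unfolding borel_group_def borel_alg_def b'_def by auto
  have bb': "b * b' = 1\<^sub>m n"
    using borel_group_inverse(2)[OF b] unfolding b'_def .
  have d: "(b * r * b') $$ (k, k) = r $$ (k, k)"
    unfolding b'_def by (rule borel_conj_diag[OF b r k])
  have "b * l_mat n r k * b' = b * r * b' - r $$ (k, k) \<cdot>\<^sub>m (b * b')"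
    unfolding l_mat_def using c
    by (simp add: mult_minus_distrib_mat[of _ n n _ n] minus_mult_distrib_mat[of _ n n _ _ n]
        mult_smult_distrib[of _ n n _ n] mult_smult_assoc_mat[of _ n n _ n])
  then show ?thesis unfolding l_mat_def d bb' by simp
qed

lemma l_mat_foldr_conj:
  assumes b: "b \<in> borel_group n" and r: "r \<in> borel_alg n" and ks: "set ks \<subseteq> {..<n}"
  defines "b' \<equiv> the (mat_inverse b)"
  shows "foldr (\<lambda>k M. l_mat n (b * r * b') k * M) ks (1\<^sub>m n)
       = b * foldr (\<lambda>k M. l_mat n r k * M) ks (1\<^sub>m n) * b'"
  using ks
proof (induction ks)
  case Nil
  show ?case
    using b borel_group_inverse(2)[OF b] unfolding borel_group_def b'_def by auto
next
  case (Cons k ks)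
  let ?L = "l_mat n r k" and ?M = "foldr (\<lambda>k M. l_mat n r k * M) ks (1\<^sub>m n)"
  have c: "b \<in> carrier_mat n n" "b' \<in> carrier_mat n n"
      "?L \<in> carrier_mat n n" "?M \<in> carrier_mat n n"
    using b borel_group_inverse(1)[OF b] l_mat_borel[OF r] l_mat_foldr_borel[OF r]
    unfolding borel_group_def b'_def by (auto intro: borel_alg_carrier)
  have "(b * ?L * b') * (b * ?M * b') = b * ?L * (b' * b) * (?M * b')"
    using c by (simp add: assoc_mult_mat[of _ n n _ n _ n])
  also have "\<dots> = b * (?L * ?M) * b'"
    using c borel_group_inverse(3)[OF b] unfolding b'_def
    by (simp add: assoc_mult_mat[of _ n n _ n _ n])
  finally show ?case
    using Cons l_mat_conj[OF b r] unfolding b'_def by simp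
qed

lemma l_prod_borel: "r \<in> borel_alg n \<Longrightarrow> l_prod n \<iota> r \<in> borel_alg n"
  unfolding l_prod_def by (rule l_mat_foldr_borel)

lemma l_prod_comm: "r \<in> borel_alg n \<Longrightarrow> r * l_prod n \<iota> r = l_prod n \<iota> r * r"
  unfolding l_prod_def by (rule l_mat_foldr_comm)

lemma l_prod_conj:
  assumes "b \<in> borel_group n" and "r \<in> borel_alg n"
  shows "l_prod n \<iota> (b * r * the (mat_inverse b)) = b * l_prod n \<iota> r * the (mat_inverse b)"
  unfolding l_prod_def by (rule l_mat_foldr_conj[OF assms]) auto

lemma l_prod_diag:
  assumes r: "r \<in> borel_alg n" and m: "m < n" and "m \<noteq> \<iota>"
  shows "l_prod n \<iota> r $$ (m, m) = 0"
  unfolding l_prod_def l_mat_foldr_diag[OF r m] using assms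
  by (auto simp: prod_list_zero_iff)

lemma l_prod_diag_nonzero:
  assumes r: "r \<in> borel_alg n" and \<iota>: "\<iota> < n" and card: "card {a. eigenvalue r a} = n"
  shows "l_prod n \<iota> r $$ (\<iota>, \<iota>) \<noteq> 0"
  unfolding l_prod_def l_mat_foldr_diag[OF r \<iota>]
  using card[unfolded card_eigenvalues_eq_iff[OF r]] \<iota> by (auto simp: prod_list_zero_iff)

lemma mat_trace_l_prod_mult:
  assumes r: "r \<in> borel_alg n" and \<iota>: "\<iota> < n" and M: "M \<in> borel_alg n"
  shows "mat_trace (l_prod n \<iota> r * M) = l_prod n \<iota> r $$ (\<iota>, \<iota>) * M $$ (\<iota>, \<iota>)"
proof -
  let ?P = "l_prod n \<iota> r"
  have "mat_trace (?P * M) = (\<Sum>k<n. ?P $$ (k, k) * M $$ (k, k))"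
    unfolding mat_trace_def
    using borel_alg_carrier[OF l_prod_borel[OF r, of \<iota>]]
    by (intro sum.cong) (auto simp: borel_alg_mult_diag[OF l_prod_borel[OF r] M]
        simp del: index_mult_mat(1))
  also have "\<dots> = (\<Sum>k\<in>{\<iota>}. ?P $$ (k, k) * M $$ (k, k))"
    by (rule sum.mono_neutral_right) (use \<iota> l_prod_diag[OF r] in auto)
  finally show ?thesis by simp
qed

lemma mat_trace_l_prod:
  assumes r: "r \<in> borel_alg n" and \<iota>: "\<iota> < n"
  shows "mat_trace (l_prod n \<iota> r) = l_prod n \<iota> r $$ (\<iota>, \<iota>)"
proof -
  have "1\<^sub>m n \<in> borel_alg n" by (auto simp: borel_alg_def)
  from mat_trace_l_prod_mult[OF r \<iota> this] show ?thesis
    using borel_alg_carrier[OF l_prod_borel[OF r, of \<iota>]] \<iota> by simp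
qed

section \<open>The eliminated moment matrix and the closed formula\<close>

lemma elim_subst_lower:
  assumes "s \<in> lower_mats n"
  shows "elim_subst n r s i j \<in> lower_mats n"
  using assms unfolding lower_mats_def elim_subst_def by auto

text \<open>The recursion for the entries of \<open>s\<close> is equivalent to the vanishing of the moment matrix below
  the diagonal, which is what makes the trace of its product with \<open>l_prod\<close> a sum over diagonals.\<close>

lemma moment_mat_elim_subst_borel:
  assumes p: "(r, S, i, j) \<in> cotangent_rss n" and s: "s \<in> lower_mats n"
  shows "moment_mat r (elim_subst n r s i j) i j \<in> borel_alg n"
proof -
  let ?s = "elim_subst n r s i j"
  have c: "r \<in> carrier_mat n n" "?s \<in> carrier_mat n n" "i \<in> carrier_mat n 1" "j \<in> carrier_mat 1 n"
    using p unfolding cotangent_rss_def cotangent_def borel_alg_def elim_subst_def by auto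
  have "\<forall>\<iota><n. \<forall>\<gamma><\<iota>. moment_mat r ?s i j $$ (\<iota>, \<gamma>) = 0"
    unfolding elim_entry_correct[OF p elim_subst_lower[OF s]] by (auto simp: elim_subst_def)
  moreover have "moment_mat r ?s i j \<in> carrier_mat n n"
    using c unfolding moment_mat_def by auto
  ultimately show ?thesis
    unfolding borel_alg_def by (auto intro!: upper_triangularI)
qed

lemma F_fun_trace_formula:
  assumes p: "(r, S, i, j) \<in> cotangent_rss n" and \<iota>: "\<iota> < n"
  shows "mat_trace (l_prod n \<iota> r) \<noteq> 0"
    and "F_fun n \<iota> (r, S, i, j)
       = inverse (mat_trace (l_prod n \<iota> r)) * mat_trace (j * l_prod n \<iota> r * i)"
proof -
  let ?P = "l_prod n \<iota> r" and ?s = "elim_subst n r (lower_rep n S) i j"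
  have r: "r \<in> borel_alg n" and S: "S \<in> borel_dual n" and i: "i \<in> carrier_mat n 1"
    and j: "j \<in> carrier_mat 1 n" and card: "card {a. eigenvalue r a} = n"
    using p unfolding cotangent_rss_def cotangent_def by auto
  show nz: "mat_trace ?P \<noteq> 0"
    using mat_trace_l_prod[OF r \<iota>] l_prod_diag_nonzero[OF r \<iota> card] by simp
  have s: "lower_rep n S \<in> lower_mats n"
    unfolding lower_rep_def using theI'[OF lower_rep_unique[OF S]] by simp
  have "mat_trace ?P * F_fun n \<iota> (r, S, i, j) = mat_trace (?P * moment_mat r ?s i j)"
    using mat_trace_l_prod_mult[OF r \<iota> moment_mat_elim_subst_borel[OF p s]]
    unfolding mat_trace_l_prod[OF r \<iota>] F_fun_def by simp
  also have "\<dots> = mat_trace (j * ?P * i)"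
  proof (rule mat_trace_commuting_moment_mat[OF _ _ _ i j l_prod_comm[OF r]])
    show "?s \<in> carrier_mat n n" unfolding elim_subst_def by simp
  qed (use borel_alg_carrier r l_prod_borel[OF r] in auto)
  finally show "F_fun n \<iota> (r, S, i, j) = inverse (mat_trace ?P) * mat_trace (j * ?P * i)"
    using nz by (simp add: field_simps)
qed

lemma F_fun_borel_invariant:
  assumes \<iota>: "\<iota> < n"
  shows "borel_invariant_on_rss n (F_fun n \<iota>)"
  unfolding borel_invariant_on_rss_def
proof (intro ballI)
  fix b p assume b: "b \<in> borel_group n" and p: "p \<in> cotangent_rss n"
  obtain r S i j where p_eq: "p = (r, S, i, j)" by (cases p)
  define b' where "b' = the (mat_inverse b)"
  let ?P = "l_prod n \<iota> r" and ?r = "b * r * b'"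
  have r: "r \<in> borel_alg n" and i: "i \<in> carrier_mat n 1" and j: "j \<in> carrier_mat 1 n"
    using p unfolding p_eq cotangent_rss_def cotangent_def by auto
  have c: "b \<in> carrier_mat n n" "b' \<in> carrier_mat n n" "?P \<in> carrier_mat n n"
    using b borel_group_inverse(1)[OF b] l_prod_borel[OF r]
    unfolding borel_group_def b'_def by (auto intro: borel_alg_carrier)
  have b'b: "b' * b = 1\<^sub>m n"
    using borel_group_inverse(3)[OF b] unfolding b'_def .
  have P: "l_prod n \<iota> ?r = b * ?P * b'"
    unfolding b'_def by (rule l_prod_conj[OF b r])
  have "mat_trace (b * ?P * b') = mat_trace (b' * (b * ?P))"
    using c by (intro mat_trace_mult_comm) auto
  also have "b' * (b * ?P) = (b' * b) * ?P"
    using c by simp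
  also have "\<dots> = ?P"
    using c b'b by simp
  finally have tr: "mat_trace (l_prod n \<iota> ?r) = mat_trace ?P"
    unfolding P .
  have "j * b' * (b * ?P * b') * (b * i) = j * (b' * b) * ?P * (b' * b) * i"
    using c i j
    by (simp add: assoc_mult_mat[of _ _ n _ n _ n] assoc_mult_mat[of _ _ n _ n _ 1]
        del: assoc_mult_mat)
  also have "\<dots> = j * ?P * i"
    using c i j b'b by simp
  finally have jPi: "j * b' * l_prod n \<iota> ?r * (b * i) = j * ?P * i"
    unfolding P .
  have act: "borel_act n b p = (?r, mat_class n (b * lower_rep n S * b'), b * i, j * b')"
    unfolding p_eq borel_act_def b'_def by (simp add: Let_def)
  have "borel_act n b p \<in> cotangent_rss n"
    using b p by (rule borel_act_rss)
  then have "F_fun n \<iota> (borel_act n b p)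
      = inverse (mat_trace (l_prod n \<iota> ?r)) * mat_trace (j * b' * l_prod n \<iota> ?r * (b * i))"
    unfolding act by (rule F_fun_trace_formula(2)) (rule \<iota>)
  also have "\<dots> = F_fun n \<iota> p"
    unfolding tr jPi p_eq using F_fun_trace_formula(2)[OF p[unfolded p_eq] \<iota>] by simp
  finally show "F_fun n \<iota> (borel_act n b p) = F_fun n \<iota> p" .
qed

theorem proposition6p8:
  fixes n \<iota> :: nat
  assumes "n \<ge> 1" and "\<iota> < n"
  shows "(\<forall>(r, S, i, j) \<in> cotangent_rss n.
            mat_trace (l_prod n \<iota> r) \<noteq> 0 \<and>
            F_fun n \<iota> (r, S, i, j) =
              inverse (mat_trace (l_prod n \<iota> r)) * mat_trace (j * l_prod n \<iota> r * i))
         \<and> borel_invariant_on_rss n (F_fun n \<iota>)"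
  using F_fun_trace_formula[OF _ \<open>\<iota> < n\<close>] F_fun_borel_invariant[OF \<open>\<iota> < n\<close>] by auto

end
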